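(* For positive integers $n,m$, let $b(n,m)$ be the number of Bott manifolds of Bott--Samelson type determined by the sequences in $[n]^m$, that is, $b(n,m)=|\{B_{\mathbf i}:\mathbf i\in[n]^m\}|$. Then, as formal power series in $x$ and $y$, \[ \sum_{n,m\ge1}\frac{b(n,m)}{m!}x^m y^n=\frac{1}{y(1-y)}\left(\exp\left(\frac{y}{2}\left(\frac{1}{1-y(e^x-1)}+y(e^x-1)-1\right)\right)-1\right). \]
   Context: Notation: $[n]=\{1,\dots,n\}$. For $\mathbf i=(i_1,\dots,i_m)\in[n]^m$, $B_{\mathbf i}=[b_{j,k}]$ is the $m\times m$ lower triangular integer matrix with $b_{j,j}=-1$ for all $j\in[m]$, $b_{k,j}=0$ for $1\le k<j\le m$, and, for $1\le k<j\le m$, $b_{j,k}=-2$ if $i_j=i_k$, $b_{j,k}=1$ if $|i_j-i_k|=1$, and $b_{j,k}=0$ otherwise. Bott manifolds of dimension $m$ correspond bijectively to $m\times m$ lower triangular integer matrices with diagonal entries $-1$ (Bott matrices), and the Bott manifolds of Bott--Samelson type determined by sequences in $[n]^m$ are those whose Bott matrix is $B_{\mathbf i}$ for some $\mathbf i\in[n]^m$; they are counted via their Bott matrices. *)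

theory Defs
  imports
    "Jordan_Normal_Form.Matrix"
    "HOL-Computational_Algebra.Formal_Power_Series"
begin

text \<open>
  A sequence in \<open>[n]^m\<close> is a list of length \<open>m\<close> with entries in \<open>{1..n}\<close>.
\<close>

definition seqs :: "nat \<Rightarrow> nat \<Rightarrow> nat list set" where
  "seqs n m = {s. length s = m \<and> set s \<subseteq> {1..n}}"

text \<open>
  Rows, columns and list positions are numbered from \<open>0\<close>, so the entry at \<open>(j, k)\<close> below is the
  entry \<open>b\<^bsub>j+1,k+1\<^esub>\<close> of the matrix. The entries of \<open>s\<close> are cast to \<open>int\<close> because
  subtraction on \<open>nat\<close> is truncated.
\<close>

definition bott_samelson_matrix :: "nat list \<Rightarrow> int mat" where
  "bott_samelson_matrix s =
     mat (length s) (length s) (\<lambda>(j, k).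
       if j < k then 0
       else if j = k then -1
       else if s ! j = s ! k then -2
       else if \<bar>int (s ! j) - int (s ! k)\<bar> = 1 then 1
       else 0)"

text \<open>
  Bott manifolds of dimension \<open>m\<close> correspond bijectively to Bott matrices of size \<open>m\<close>, so those of
  Bott--Samelson type are counted by their matrices.
\<close>

definition bott_samelson_count :: "nat \<Rightarrow> nat \<Rightarrow> nat" where
  "bott_samelson_count n m = card (bott_samelson_matrix ` seqs n m)"

text \<open>
  A formal power series in \<open>x\<close> and \<open>y\<close> over the rationals is a power series in \<open>y\<close> (outer
  \<open>fps\<close>) whose coefficients are power series in \<open>x\<close> (inner \<open>fps\<close>).
\<close>

type_synonym fps_xy = "rat fps fps"

definition var_y :: fps_xy where
  "var_y = fps_X"

text \<open>The series whose coefficient of \<open>x^m * y^n\<close> is \<open>c n m\<close> for \<open>n, m \<ge> 1\<close>, and \<open>0\<close> otherwise.\<close>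

definition fps_xy_sum_ge1 :: "(nat \<Rightarrow> nat \<Rightarrow> rat) \<Rightarrow> fps_xy" where
  "fps_xy_sum_ge1 c =
     Abs_fps (\<lambda>n. Abs_fps (\<lambda>m. if n \<ge> 1 \<and> m \<ge> 1 then c n m else 0))"

text \<open>
  The library's \<open>fps_exp\<close> needs coefficients in a field, which \<open>rat fps\<close> is not. As for
  \<open>fps_compose\<close> in general, \<open>exp_y f\<close> is the exponential of \<open>f\<close> only if \<open>f\<close> has no term of
  degree \<open>0\<close> in \<open>y\<close>; the exponential of a series in \<open>x\<close> alone is \<open>exp_x\<close>.
\<close>

definition exp_y :: "fps_xy \<Rightarrow> fps_xy" where
  "exp_y f = Abs_fps (\<lambda>k. fps_const (1 / fact k)) oo f"

definition exp_x :: fps_xy where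
  "exp_x = fps_const (fps_exp 1)"

text \<open>
  In the generating function, every division by a series has to be a genuine quotient, because
  division on \<open>fps\<close> silently drops the part of negative degree in \<open>y\<close>. The
  lemmas below confirm this,
  and that \<open>exp_y\<close> is applied to a series without a term of degree \<open>0\<close> in \<open>y\<close>.
\<close>

lemma fps_xy_unit_inverse:
  fixes f :: fps_xy
  assumes "fps_nth f 0 * inverse (fps_nth f 0) = 1"
  shows "f * inverse f = 1"
  using fps_right_inverse[OF assms] by (simp add: fps_inverse_def)

lemma two_times_half_var_y: "2 * (var_y / 2) = var_y"
proof -
  have nth: "fps_nth (2 :: fps_xy) 0 = 2"
    by (simp add: numeral_fps_const)
  have "(2 :: rat fps) * inverse 2 = 1"
    by (rule inverse_mult_eq_1') (simp add: numeral_fps_const)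
  then have inv: "(2 :: fps_xy) * inverse 2 = 1"
    by (intro fps_xy_unit_inverse) (simp only: nth)
  have "subdegree (2 :: fps_xy) = 0"
    by (rule subdegree_eq_0) (simp only: nth, simp)
  then have "var_y / 2 = var_y * inverse 2"
    by (rule fps_divide_unit')
  with inv show ?thesis
    by (metis mult.left_commute mult.right_neutral)
qed

lemma geometric_times:
  "(1 - var_y * (exp_x - 1)) * (1 / (1 - var_y * (exp_x - 1))) = 1"
proof -
  let ?g = "1 - var_y * (exp_x - 1)"
  have g0: "fps_nth ?g 0 = 1"
    by (simp add: var_y_def)
  then have "?g * inverse ?g = 1"
    by (intro fps_xy_unit_inverse) (simp only: g0, simp)
  moreover have "subdegree ?g = 0"
    by (rule subdegree_eq_0) (simp only: g0, simp)
  ultimately show ?thesis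
    by (simp add: fps_divide_unit')
qed

lemma exponent_nth_0:
  "fps_nth (var_y / 2 * (1 / (1 - var_y * (exp_x - 1)) + var_y * (exp_x - 1) - 1)) 0 = 0"
proof -
  have "fps_nth (2 * (var_y / 2)) 0 = 0"
    by (simp only: two_times_half_var_y) (simp add: var_y_def)
  then have "fps_nth (var_y / 2) 0 = 0"
    by (simp add: numeral_fps_const)
  then show ?thesis
    by simp
qed

lemma exp_y_minus_1_div_times:
  "(exp_y f - 1) / (var_y * (1 - var_y)) * (var_y * (1 - var_y)) = exp_y f - 1"
proof -
  let ?e = "exp_y f - 1"
  have u0: "fps_nth (1 - var_y) 0 = 1"
    by (simp add: var_y_def)
  then have inv: "(1 - var_y) * inverse (1 - var_y) = 1"
    by (intro fps_xy_unit_inverse) (simp only: u0, simp)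
  have "subdegree (1 - var_y) = 0"
    by (rule subdegree_eq_0) (simp only: u0, simp)
  moreover have "1 - var_y \<noteq> 0"
    using inv by auto
  ultimately have deg: "subdegree (var_y * (1 - var_y)) = 1"
    by (simp add: var_y_def)
  have "unit_factor (var_y * (1 - var_y)) = 1 - var_y"
    unfolding fps_unit_factor_def deg unfolding var_y_def mult.commute[of fps_X]
    by (rule fps_shift_times_fps_X')
  then have div: "?e / (var_y * (1 - var_y)) = fps_shift 1 (?e * inverse (1 - var_y))"
    unfolding fps_divide_def deg by (simp only:)
  define h where "h = ?e * inverse (1 - var_y)"
  have e0: "fps_nth ?e 0 = 0"
    by (simp add: exp_y_def)
  have "fps_nth h 0 = 0"
    unfolding h_def fps_mult_nth_0 e0 by simp
  then have "fps_shift 1 h * fps_X = h"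
    by (intro fps_ext[where 'a = "rat fps"]) (simp add: fps_X_mult_right_nth)
  then have "?e / (var_y * (1 - var_y)) * var_y = h"
    by (simp only: div h_def[symmetric]) (simp only: var_y_def)
  then have "?e / (var_y * (1 - var_y)) * (var_y * (1 - var_y)) = h * (1 - var_y)"
    by (simp only: mult.assoc[symmetric])
  also have "\<dots> = ?e * ((1 - var_y) * inverse (1 - var_y))"
    unfolding h_def by (simp only: ac_simps)
  finally show ?thesis
    by (simp only: inv mult_1_right)
qed

end

theory Submission
  imports Defs "HOL-Library.Disjoint_Sets" "HOL-Combinatorics.Multiset_Permutations"
begin

text \<open>
  The matrix of a sequence records which positions carry equal and which carry adjacent values.
  Equal values cut the positions into blocks, and adjacency makes the blocks the vertices of a
  disjoint union of paths, one path for each maximal run of consecutive values. A matrix with \<open>c\<close>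
  paths and \<open>k\<close> blocks arises from \<open>[n]^m\<close> iff \<open>k + c - 1 \<le> n\<close>, since the runs have to be
  separated by unused values. It is represented by exactly \<open>c! 2^d\<close> lists of lists of blocks, where
  \<open>d\<close> is the number of paths with at least two blocks: a path is determined up to reversal, and the
  set of paths up to order. Ordered partitions into \<open>k\<close> blocks have exponential generating function
  \<open>(e^x - 1)^k\<close>, so with \<open>u = y (e^x - 1)\<close> a single path contributes
  \<open>y (u + (u^2 + u^3 + \<dots>) / 2)\<close>, the argument of the exponential. Dividing by \<open>y\<close> turns \<open>k + c\<close>
  into \<open>k + c - 1\<close>, and dividing by \<open>1 - y\<close> sums over all sizes up to \<open>n\<close>.
\<close>

section \<open>Maximal paths in a graph\<close>

text \<open>Letting \<open>b\<close> range over all of \<open>V\<close>, not just over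
  \<open>set p\<close>, makes \<open>p\<close> a whole component: no edge leads from
  \<open>p\<close> to a vertex outside it, and inside it only consecutive vertices are
  joined.\<close>

definition maximal_path :: "('a \<Rightarrow> 'a \<Rightarrow> bool) \<Rightarrow> 'a set \<Rightarrow> 'a list \<Rightarrow> bool" where
  "maximal_path E V p \<longleftrightarrow> p \<noteq> [] \<and> distinct p \<and> set p \<subseteq> V \<and>
    (\<forall>a<length p. \<forall>b\<in>V. E (p ! a) b \<longleftrightarrow>
      (\<exists>c<length p. b = p ! c \<and> (c = Suc a \<or> a = Suc c)))"

lemma maximal_path_neighbour:
  assumes "maximal_path E V p" "a < length p" "b \<in> V"
  shows "E (p ! a) b \<longleftrightarrow> (\<exists>c<length p. b = p ! c \<and> (c = Suc a \<or> a = Suc c))"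
  using assms unfolding maximal_path_def by blast

lemma maximal_path_rev:
  assumes "maximal_path E V p"
  shows "maximal_path E V (rev p)"
proof -
  let ?n = "length p"
  have "E (rev p ! a) b \<longleftrightarrow> (\<exists>c<length (rev p). b = rev p ! c \<and> (c = Suc a \<or> a = Suc c))"
    if a: "a < ?n" and b: "b \<in> V" for a b
  proof -
    have "E (rev p ! a) b \<longleftrightarrow> (\<exists>c<?n. b = p ! c \<and> (c = Suc (?n - Suc a) \<or> ?n - Suc a = Suc c))"
      using maximal_path_neighbour[OF assms, of "?n - Suc a" b] a b by (simp add: rev_nth)
    also have "\<dots> \<longleftrightarrow> (\<exists>c<?n. b = rev p ! c \<and> (c = Suc a \<or> a = Suc c))"
    proof (intro iffI; elim exE conjE)
      fix c assume c: "c < ?n" "b = p ! c" "c = Suc (?n - Suc a) \<or> ?n - Suc a = Suc c"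
      then show "\<exists>c<?n. b = rev p ! c \<and> (c = Suc a \<or> a = Suc c)"
        using a by (intro exI[of _ "?n - Suc c"]) (auto simp: rev_nth)
    next
      fix c assume c: "c < ?n" "b = rev p ! c" "c = Suc a \<or> a = Suc c"
      then show "\<exists>c<?n. b = p ! c \<and> (c = Suc (?n - Suc a) \<or> ?n - Suc a = Suc c)"
        using a by (intro exI[of _ "?n - Suc c"]) (auto simp: rev_nth)
    qed
    finally show ?thesis by simp
  qed
  then show ?thesis
    using assms unfolding maximal_path_def by simp
qed

text \<open>Starting at a common vertex, walk along \<open>p\<close> in both directions. Each step
  follows an edge, and \<open>q\<close> contains every neighbour of its own vertices, so the walk
  never leaves \<open>q\<close>.\<close>

lemma maximal_path_subset:
  assumes p: "maximal_path E V p" and q: "maximal_path E V q"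
    and meet: "set p \<inter> set q \<noteq> {}"
  shows "set p \<subseteq> set q"
proof -
  have walk: "p ! c \<in> set q"
    if "p ! a \<in> set q" "a < length p" "c < length p" "c = Suc a \<or> a = Suc c" for a c
  proof -
    have V: "p ! c \<in> V"
      using p that(3) unfolding maximal_path_def by auto
    have "E (p ! a) (p ! c)"
      using maximal_path_neighbour[OF p that(2) V] that(3,4) by blast
    moreover obtain a' where "a' < length q" "p ! a = q ! a'"
      using \<open>p ! a \<in> set q\<close> by (metis in_set_conv_nth)
    ultimately show ?thesis
      using maximal_path_neighbour[OF q _ V, of a'] by auto
  qed
  obtain i where i: "i < length p" "p ! i \<in> set q"
    using meet by (metis disjoint_iff in_set_conv_nth)
  have up: "p ! a \<in> set q" if "i \<le> a" "a < length p" for a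
    using that
  proof (induction a rule: dec_induct)
    case base
    show ?case by (rule i(2))
  next
    case (step a)
    then show ?case using walk[of a "Suc a"] by simp
  qed
  have down: "p ! a \<in> set q" if "a \<le> i" for a
    using that
  proof (induction a rule: inc_induct)
    case base
    show ?case by (rule i(2))
  next
    case (step a)
    then show ?case using walk[of "Suc a" a] i(1) by simp
  qed
  show ?thesis
  proof
    fix b assume "b \<in> set p"
    then obtain a where a: "a < length p" "b = p ! a"
      by (auto simp: in_set_conv_nth)
    show "b \<in> set q"
      using up[of a] down[of a] a by (cases "i \<le> a") auto
  qed
qed

text \<open>Strong induction on the position: the vertex after \<open>p ! b\<close> is a neighbour
  of \<open>q ! b\<close>, hence stands just after or just before position \<open>b\<close> in
  \<open>q\<close>. The one before is already identified with the preceding vertex of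
  \<open>p\<close>, so distinctness rules it out.\<close>

lemma maximal_path_eq_if_hd_eq:
  assumes p: "maximal_path E V p" and q: "maximal_path E V q"
    and len: "length p = length q" and hd: "p ! 0 = q ! 0"
  shows "p = q"
proof (rule nth_equalityI[OF len])
  fix a assume "a < length p"
  then show "p ! a = q ! a"
  proof (induction a rule: less_induct)
    case (less a)
    show ?case
    proof (cases a)
      case 0
      then show ?thesis using hd by simp
    next
      case (Suc b)
      have V: "p ! a \<in> V"
        using p less.prems unfolding maximal_path_def by auto
      have eq: "p ! b = q ! b"
        using less Suc by simp
      have "E (p ! b) (p ! a)"
        using maximal_path_neighbour[OF p _ V, of b] less.prems Suc by auto
      then obtain c where c: "c < length q" "p ! a = q ! c" "c = Suc b \<or> b = Suc c"
        using maximal_path_neighbour[OF q _ V, of b] less.prems Suc len eq by auto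
      have "b \<noteq> Suc c"
      proof
        assume b: "b = Suc c"
        then have "p ! a = p ! c"
          using less.IH[of c] less.prems Suc c(2) by simp
        then show False
          using p less.prems Suc b unfolding maximal_path_def by (auto simp: nth_eq_iff_index_eq)
      qed
      then show ?thesis using c Suc by simp
    qed
  qed
qed

text \<open>The first vertex of a maximal path has at most one neighbour, so it is an end of any other
  maximal path through the same vertices.\<close>

lemma maximal_path_unique:
  assumes p: "maximal_path E V p" and q: "maximal_path E V q"
    and meet: "set p \<inter> set q \<noteq> {}"
  shows "q = p \<or> q = rev p"
proof -
  have eq: "set p = set q"
    using maximal_path_subset[OF p q meet] maximal_path_subset[OF q p] meet by blast
  have dist: "distinct p" "distinct q"
    using p q unfolding maximal_path_def by auto
  then have len: "length p = length q"
    using eq by (metis distinct_card)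
  have ne: "p \<noteq> []" "q \<noteq> []"
    using p q unfolding maximal_path_def by auto
  obtain j where j: "j < length q" "p ! 0 = q ! j"
    using ne eq by (metis in_set_conv_nth length_greater_0_conv nth_mem)
  \<comment> \<open>At an interior position of \<open>q\<close> both list neighbours of
    \<open>q ! j\<close> would have to be \<open>p ! Suc 0\<close>, the only possible neighbour of
    \<open>p ! 0\<close>.\<close>
  have "j = 0 \<or> Suc j = length q"
  proof (rule ccontr)
    assume "\<not> (j = 0 \<or> Suc j = length q)"
    then have js: "j \<noteq> 0" "Suc j < length q" using j by auto
    have "q ! c = p ! Suc 0" if "c < length q" "c = Suc j \<or> j = Suc c" for c
    proof -
      have V: "q ! c \<in> V"
        using q that unfolding maximal_path_def by auto
      have "E (p ! 0) (q ! c)"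
        using maximal_path_neighbour[OF q j(1) V] that j(2) by auto
      then show ?thesis
        using maximal_path_neighbour[OF p _ V, of 0] ne by auto
    qed
    from this[of "Suc j"] this[of "j - 1"] js have "q ! Suc j = q ! (j - 1)" by simp
    then show False
      using dist(2) js by (simp add: nth_eq_iff_index_eq)
  qed
  then show ?thesis
  proof
    assume "j = 0"
    then show ?thesis
      using maximal_path_eq_if_hd_eq[OF p q len] j by simp
  next
    assume "Suc j = length q"
    then have "p ! 0 = rev q ! 0"
      using j by (simp add: rev_nth flip: \<open>Suc j = length q\<close>)
    then have "p = rev q"
      using maximal_path_eq_if_hd_eq[OF p maximal_path_rev[OF q]] len by simp
    then show ?thesis by simp
  qed
qed

section \<open>Path systems and the relations they induce\<close>

fun links :: "'a set list \<Rightarrow> ('a \<times> 'a) set" where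
  "links (b # c # p) = b \<times> c \<union> c \<times> b \<union> links (c # p)"
| "links _ = {}"

definition linked :: "'a set list list \<Rightarrow> ('a \<times> 'a) set" where
  "linked ps = (\<Union>p\<in>set ps. links p)"

definition same_block :: "'a set set \<Rightarrow> ('a \<times> 'a) set" where
  "same_block P = {(i, j). \<exists>b\<in>P. i \<in> b \<and> j \<in> b}"

text \<open>Orientation and order of the paths are kept, although the induced relations see neither:
  the ordered objects are easy to count, and the overcount is divided out later. Blocks are nonempty
  by \<open>partition_on\<close>.\<close>

definition path_systems :: "'a set \<Rightarrow> 'a set list list set" where
  "path_systems A =
    {ps. [] \<notin> set ps \<and> distinct (concat ps) \<and> partition_on A (set (concat ps))}"

lemma mem_links_iff:
  "(i, j) \<in> links p \<longleftrightarrow>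
    (\<exists>a c. a < length p \<and> c < length p \<and> (c = Suc a \<or> a = Suc c) \<and> i \<in> p ! a \<and> j \<in> p ! c)"
proof (induction p rule: links.induct)
  case (1 b d p)
  show ?case (is "_ \<longleftrightarrow> ?R (b # d # p)")
  proof
    assume "(i, j) \<in> links (b # d # p)"
    then consider "i \<in> b" "j \<in> d" | "i \<in> d" "j \<in> b" | "?R (d # p)"
      using 1 by auto
    then show "?R (b # d # p)"
    proof cases
      case 1
      then show ?thesis by (intro exI[of _ 0] exI[of _ "Suc 0"]) auto
    next
      case 2
      then show ?thesis by (intro exI[of _ 0] exI[of _ "Suc 0"]) auto
    next
      case 3
      then obtain a c where "a < length (d # p)" "c < length (d # p)" "c = Suc a \<or> a = Suc c"
        "i \<in> (d # p) ! a" "j \<in> (d # p) ! c"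
        by blast
      then show ?thesis by (intro exI[of _ "Suc a"] exI[of _ "Suc c"]) auto
    qed
  next
    assume "?R (b # d # p)"
    then obtain a c where ac: "a < length (b # d # p)" "c < length (b # d # p)"
      "c = Suc a \<or> a = Suc c" "i \<in> (b # d # p) ! a" "j \<in> (b # d # p) ! c"
      by blast
    show "(i, j) \<in> links (b # d # p)"
    proof (cases "a = 0 \<or> c = 0")
      case True
      then show ?thesis using ac by auto
    next
      case False
      then obtain a' c' where "a = Suc a'" "c = Suc c'" by (meson not0_implies_Suc)
      then have "?R (d # p)"
        using ac by (intro exI[of _ a'] exI[of _ c']) auto
      then show ?thesis using 1 by auto
    qed
  qed
qed auto

lemma links_rev: "links (rev p) = links p"
proof -
  have sub: "links (rev p) \<subseteq> links p" for p :: "'a set list"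
  proof (clarify, unfold mem_links_iff, elim exE conjE)
    fix i j a c
    assume "a < length (rev p)" "c < length (rev p)" "c = Suc a \<or> a = Suc c"
      "i \<in> rev p ! a" "j \<in> rev p ! c"
    then show "\<exists>a c. a < length p \<and> c < length p \<and> (c = Suc a \<or> a = Suc c) \<and> i \<in> p ! a \<and> j \<in> p ! c"
      by (intro exI[of _ "length p - Suc a"] exI[of _ "length p - Suc c"]) (auto simp: rev_nth)
  qed
  show ?thesis
    using sub[of p] sub[of "rev p"] by auto
qed

text \<open>A product with the empty set is empty, so an empty block cuts a list of blocks in two.
  This is the effect of a value that the sequence does not use.\<close>

lemma links_append_empty: "links (p @ {} # q) = links p \<union> links q"
proof (induction p rule: links.induct)
  case ("2_1")
  show ?case by (cases q) auto
next
  case ("2_2" v)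
  show ?case by (cases q) auto
qed auto

text \<open>Blocks are disjoint and nonempty, so a linked pair of elements determines its two
  blocks, and each block occurs at one position of one path. The graph is built from
  \<open>linked ps\<close> and the set of blocks alone, so systems with the same relations have
  their paths in the same graph.\<close>

lemma path_systems_maximal_path:
  assumes ps: "ps \<in> path_systems A" and p: "p \<in> set ps"
  shows "maximal_path (\<lambda>b c. \<exists>i\<in>b. \<exists>j\<in>c. (i, j) \<in> linked ps) (set (concat ps)) p"
proof -
  have dc: "distinct (concat ps)" and part: "partition_on A (set (concat ps))" and ne: "[] \<notin> set ps"
    using ps by (auto simp: path_systems_def)
  have disj: "b = c" if "b \<in> set (concat ps)" "c \<in> set (concat ps)" "i \<in> b" "i \<in> c" for b c i
    using partition_onD2[OF part] that unfolding disjoint_def by blast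
  have nonempty: "b \<noteq> {}" if "b \<in> set (concat ps)" for b
    using partition_onD3[OF part] that by blast
  have dp: "distinct p"
    using dc p by (auto simp: distinct_concat_iff)
  have "(\<exists>i\<in>p ! a. \<exists>j\<in>b. (i, j) \<in> linked ps) \<longleftrightarrow>
      (\<exists>c<length p. b = p ! c \<and> (c = Suc a \<or> a = Suc c))"
    if a: "a < length p" and b: "b \<in> set (concat ps)" for a b
  proof
    assume "\<exists>i\<in>p ! a. \<exists>j\<in>b. (i, j) \<in> linked ps"
    then obtain i j q where ij: "i \<in> p ! a" "j \<in> b" "q \<in> set ps" "(i, j) \<in> links q"
      unfolding linked_def by blast
    then obtain d c where q: "d < length q" "c < length q" "c = Suc d \<or> d = Suc c" "i \<in> q ! d" "j \<in> q ! c"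
      by (auto simp: mem_links_iff)
    have mem: "p ! a \<in> set (concat ps)" "q ! d \<in> set (concat ps)" "q ! c \<in> set (concat ps)"
      using nth_mem[OF a] nth_mem[OF q(1)] nth_mem[OF q(2)] p ij(3) by auto
    have eq: "p ! a = q ! d" "b = q ! c"
      using disj[OF mem(1,2) ij(1) q(4)] disj[OF b mem(3) ij(2) q(5)] by auto
    then have "p ! a \<in> set p \<inter> set q"
      using nth_mem[OF a] nth_mem[OF q(1)] by auto
    then have "p = q"
      using dc p ij(3) by (metis distinct_concat_iff empty_iff)
    then have "d = a"
      using eq dp a q(1) by (simp add: nth_eq_iff_index_eq)
    then show "\<exists>c<length p. b = p ! c \<and> (c = Suc a \<or> a = Suc c)"
      using q eq \<open>p = q\<close> by auto
  next
    assume "\<exists>c<length p. b = p ! c \<and> (c = Suc a \<or> a = Suc c)"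
    then obtain c where c: "c < length p" "b = p ! c" "c = Suc a \<or> a = Suc c" by blast
    have "p ! a \<in> set (concat ps)"
      using nth_mem[OF a] p by auto
    then obtain i j where "i \<in> p ! a" "j \<in> b"
      using nonempty b by blast
    then show "\<exists>i\<in>p ! a. \<exists>j\<in>b. (i, j) \<in> linked ps"
      using a c p unfolding linked_def UN_iff mem_links_iff by blast
  qed
  moreover have "set p \<subseteq> set (concat ps)" "p \<noteq> []"
    using ne p by auto
  ultimately show ?thesis
    using dp unfolding maximal_path_def by blast
qed

lemma path_systems_cong:
  assumes ps: "ps \<in> path_systems A" and qs: "qs \<in> path_systems A"
    and same: "same_block (set (concat ps)) = same_block (set (concat qs))"
    and linked: "linked ps = linked qs" and p: "p \<in> set ps"
  shows "p \<in> set qs \<or> rev p \<in> set qs"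
proof -
  \<comment> \<open>A partition is recovered as the quotient of \<open>A\<close> by its equivalence
    relation.\<close>
  have V: "set (concat ps) = set (concat qs)"
    using partition_on_eq_quotient[of A "set (concat ps)"] partition_on_eq_quotient[of A "set (concat qs)"]
      ps qs same unfolding path_systems_def same_block_def by simp
  have "p \<noteq> []"
    using ps p by (auto simp: path_systems_def)
  then have "hd p \<in> set (concat ps)"
    using p hd_in_set[of p] by force
  then obtain q where q: "q \<in> set qs" "hd p \<in> set q"
    unfolding V by auto
  \<comment> \<open>Both are maximal paths of one graph, and they share the block
    \<open>hd p\<close>.\<close>
  have "q = p \<or> q = rev p"
    using path_systems_maximal_path[OF ps p] path_systems_maximal_path[OF qs q(1)] q(2) \<open>p \<noteq> []\<close>
    unfolding V linked using hd_in_set[of p] by (intro maximal_path_unique) blast+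
  then show ?thesis using q(1) by auto
qed

section \<open>Paths up to reversal and the systems that share their relations\<close>

definition unoriented :: "'a list \<Rightarrow> 'a list set" where
  "unoriented p = {p, rev p}"

lemma unoriented_eq_iff: "unoriented p = unoriented q \<longleftrightarrow> p = q \<or> p = rev q"
  unfolding unoriented_def by (auto simp: doubleton_eq_iff)

text \<open>Serves to transfer \<open>set\<close> and \<open>links\<close>, neither of which depends
  on the direction of a path.\<close>

lemma image_eq_if_unoriented_image_eq:
  assumes "unoriented ` X = unoriented ` Y" and inv: "\<And>p. f (rev p) = f p"
  shows "f ` X = f ` Y"
proof -
  have sub: "f ` X \<subseteq> f ` Y" if "unoriented ` X = unoriented ` Y" for X Y
  proof
    fix z assume "z \<in> f ` X"
    then obtain x where x: "x \<in> X" "z = f x" by blast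
    then have "unoriented x \<in> unoriented ` Y"
      using that by blast
    then obtain y where "y \<in> Y" "unoriented x = unoriented y"
      by blast
    then show "z \<in> f ` Y"
      using x inv by (auto simp: unoriented_eq_iff)
  qed
  show ?thesis
    using sub[OF assms(1)] sub[OF assms(1)[symmetric]] by (rule equalityI)
qed

text \<open>Paths that agree up to reversal have the same blocks, whereas different paths of a
  system share none.\<close>

lemma path_systems_inj_unoriented:
  assumes "ps \<in> path_systems A"
  shows "inj_on unoriented (set ps)"
proof (rule inj_onI)
  fix p q assume pq: "p \<in> set ps" "q \<in> set ps" "unoriented p = unoriented q"
  then have "set p = set q"
    by (auto simp: unoriented_eq_iff)
  moreover have "p \<noteq> []"
    using assms pq by (auto simp: path_systems_def)
  ultimately have "set p \<inter> set q \<noteq> {}" by auto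
  then show "p = q"
    using assms pq unfolding path_systems_def mem_Collect_eq distinct_concat_iff by blast
qed

lemma path_systems_distinct:
  assumes "ps \<in> path_systems A"
  shows "distinct ps"
  using assms unfolding path_systems_def by (auto simp: distinct_concat_iff)

text \<open>By uniqueness of maximal paths, a system with the relations of \<open>qs\<close> can
  differ from it only in the direction and the order of its paths. Conversely, reversing and
  reordering preserve the blocks, the links and the defining conditions of a path system.\<close>

lemma path_systems_same_relations:
  assumes qs: "qs \<in> path_systems A"
  shows "{ps \<in> path_systems A. same_block (set (concat ps)) = same_block (set (concat qs)) \<and>
      linked ps = linked qs} =
    {ps. map unoriented ps \<in> permutations_of_set (unoriented ` set qs)}" (is "?L = ?R")
proof (intro equalityI subsetI)
  fix ps assume "ps \<in> ?L"
  then have ps: "ps \<in> path_systems A"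
    and rel: "same_block (set (concat ps)) = same_block (set (concat qs))" "linked ps = linked qs"
    by auto
  have "unoriented p \<in> unoriented ` set qs" if "p \<in> set ps" for p
  proof -
    have "unoriented (rev p) = unoriented p"
      by (simp add: unoriented_eq_iff)
    then show ?thesis
      using path_systems_cong[OF ps qs rel that] by (metis imageI)
  qed
  moreover have "unoriented p \<in> unoriented ` set ps" if "p \<in> set qs" for p
  proof -
    have "unoriented (rev p) = unoriented p"
      by (simp add: unoriented_eq_iff)
    then show ?thesis
      using path_systems_cong[OF qs ps rel[symmetric] that] by (metis imageI)
  qed
  ultimately have "unoriented ` set ps = unoriented ` set qs" by blast
  moreover have "distinct (map unoriented ps)"
    using path_systems_distinct[OF ps] path_systems_inj_unoriented[OF ps] by (simp add: distinct_map)
  ultimately show "ps \<in> ?R"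
    by (auto intro!: permutations_of_setI)
next
  fix ps assume "ps \<in> ?R"
  then have im: "unoriented ` set ps = unoriented ` set qs" and "distinct (map unoriented ps)"
    by (auto simp: permutations_of_set_def)
  then have dist: "distinct ps" "inj_on unoriented (set ps)"
    by (auto simp: distinct_map)
  have qs': "[] \<notin> set qs" "distinct (concat qs)" "partition_on A (set (concat qs))"
    using qs by (auto simp: path_systems_def)
  have rep: "\<exists>q\<in>set qs. unoriented p = unoriented q" if "p \<in> set ps" for p
    using im that by (metis image_iff)
  have V: "set (concat ps) = set (concat qs)"
    using image_eq_if_unoriented_image_eq[OF im, of set] by simp
  have linked: "linked ps = linked qs"
    unfolding linked_def using image_eq_if_unoriented_image_eq[OF im, of links] by (simp add: links_rev)
  have ne: "[] \<notin> set ps"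
    using rep[of "[]"] qs'(1) by (auto simp: unoriented_eq_iff)
  have "distinct p" if "p \<in> set ps" for p
    using rep[OF that] qs'(2) by (auto simp: unoriented_eq_iff distinct_concat_iff)
  moreover have "set p \<inter> set p' = {}" if pp: "p \<in> set ps" "p' \<in> set ps" "p \<noteq> p'" for p p'
  proof -
    obtain q q' where q: "q \<in> set qs" "q' \<in> set qs" "unoriented p = unoriented q" "unoriented p' = unoriented q'"
      using rep pp by meson
    then have "q \<noteq> q'"
      using pp dist(2) by (metis inj_onD)
    moreover have "set p = set q" "set p' = set q'"
      using q by (auto simp: unoriented_eq_iff)
    ultimately show ?thesis
      using qs'(2) q(1,2) by (simp add: distinct_concat_iff)
  qed
  ultimately have "distinct (concat ps)"
    using dist(1) ne by (simp add: distinct_concat_iff removeAll_id)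
  then show "ps \<in> ?L"
    using ne V linked qs'(3) by (simp add: path_systems_def)
qed

section \<open>Counting the path systems that induce given relations\<close>

lemma card_map_vimage:
  "card {xs. map f xs = ys} = (\<Prod>y\<leftarrow>ys. card (f -` {y}))"
proof (induction ys)
  case (Cons y ys)
  have "{xs. map f xs = y # ys} = (\<lambda>(x, xs). x # xs) ` ((f -` {y}) \<times> {xs. map f xs = ys})"
    by (auto simp: map_eq_Cons_conv)
  then show ?case
    using Cons by (simp add: card_image inj_on_def card_cartesian_product)
qed simp

lemma finite_map_vimage:
  assumes "\<And>y. y \<in> set ys \<Longrightarrow> finite (f -` {y})"
  shows "finite {xs. map f xs = ys}"
  using assms
proof (induction ys)
  case (Cons y ys)
  have "{xs. map f xs = y # ys} = (\<lambda>(x, xs). x # xs) ` ((f -` {y}) \<times> {xs. map f xs = ys})"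
    by (auto simp: map_eq_Cons_conv)
  then show ?case
    using Cons by simp
qed simp

lemma card_map_permutations:
  assumes "finite C" "\<And>y. y \<in> C \<Longrightarrow> finite (f -` {y})"
  shows "card {xs. map f xs \<in> permutations_of_set C} = fact (card C) * (\<Prod>y\<in>C. card (f -` {y}))"
proof -
  have "{xs. map f xs \<in> permutations_of_set C} = (\<Union>ys\<in>permutations_of_set C. {xs. map f xs = ys})"
    by auto
  also have "card \<dots> = (\<Sum>ys\<in>permutations_of_set C. card {xs. map f xs = ys})"
    using assms by (intro card_UN_disjoint) (auto intro!: finite_map_vimage dest: permutations_of_setD)
  also have "\<dots> = (\<Sum>ys\<in>permutations_of_set C. \<Prod>y\<in>C. card (f -` {y}))"
    by (intro sum.cong refl)
       (auto simp: card_map_vimage permutations_of_set_def prod.distinct_set_conv_list)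
  finally show ?thesis
    using assms by simp
qed

lemma unoriented_vimage: "unoriented -` {unoriented p} = {p, rev p}"
  by (auto simp: unoriented_eq_iff)

lemma card_unoriented_vimage:
  assumes "distinct p" "p \<noteq> []"
  shows "card (unoriented -` {unoriented p}) = (if length p = 1 then 1 else 2)"
proof (cases "length p = 1")
  case True
  then obtain b where "p = [b]" by (auto simp: length_Suc_conv)
  then show ?thesis unfolding unoriented_vimage by simp
next
  case False
  \<comment> \<open>A palindrome of length at least two would repeat its first entry at the
    end.\<close>
  have "p \<noteq> rev p"
  proof
    assume "p = rev p"
    then have "p ! 0 = rev p ! 0" by simp
    then have "p ! 0 = p ! (length p - 1)"
      using assms by (simp add: rev_nth)
    then show False
      using assms False by (cases p) (auto simp: nth_eq_iff_index_eq)
  qed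
  then show ?thesis using False unfolding unoriented_vimage by simp
qed

text \<open>The factorial counts the orders of the paths. A path with one block is its own reversal;
  every longer one has two directions.\<close>

lemma card_path_systems_same_relations:
  assumes qs: "qs \<in> path_systems A"
  shows "card {ps \<in> path_systems A. same_block (set (concat ps)) = same_block (set (concat qs)) \<and>
      linked ps = linked qs} =
    fact (length qs) * (\<Prod>p\<leftarrow>qs. if length p = 1 then 1 else 2)"
proof -
  have inj: "inj_on unoriented (set qs)" and dist: "distinct qs"
    using path_systems_inj_unoriented[OF qs] path_systems_distinct[OF qs] by auto
  have p: "distinct p \<and> p \<noteq> []" if "p \<in> set qs" for p
    using qs that by (auto simp: path_systems_def distinct_concat_iff)
  have "(\<Prod>y\<in>unoriented ` set qs. card (unoriented -` {y})) =
      (\<Prod>p\<in>set qs. if length p = 1 then 1 else 2)"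
    using p by (simp add: prod.reindex[OF inj] card_unoriented_vimage del: One_nat_def cong: prod.cong)
  moreover have "finite (unoriented -` {y})" if "y \<in> unoriented ` set qs" for y
    using that by (auto simp: unoriented_vimage)
  ultimately show ?thesis
    unfolding path_systems_same_relations[OF qs]
    by (subst card_map_permutations)
       (auto simp: card_image[OF inj] distinct_card[OF dist] prod.distinct_set_conv_list[OF dist]
         simp del: One_nat_def)
qed

section \<open>Ordered partitions\<close>

definition ordered_partitions :: "'a set \<Rightarrow> nat \<Rightarrow> 'a set list set" where
  "ordered_partitions A k = {bs. distinct bs \<and> partition_on A (set bs) \<and> length bs = k}"

lemma ordered_partitions_0: "ordered_partitions A 0 = (if A = {} then {[]} else {})"
  by (auto simp: ordered_partitions_def partition_on_def)

text \<open>Splitting off the first block leaves an ordered partition of the remaining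
  elements.\<close>

lemma ordered_partitions_Suc:
  "ordered_partitions A (Suc k) =
    (\<lambda>(b, bs). b # bs) ` (SIGMA b:Pow A - {{}}. ordered_partitions (A - b) k)" (is "?L = ?R")
proof -
  have iff: "b # bs \<in> ?L \<longleftrightarrow> b \<in> Pow A - {{}} \<and> bs \<in> ordered_partitions (A - b) k" for b bs
  proof (cases "disjnt b (\<Union>(set bs))")
    case True
    have "b \<notin> set bs" if "b \<noteq> {}"
      using True that by (auto simp: disjnt_def)
    then show ?thesis
      using partition_on_insert[OF True, of A] by (auto simp: ordered_partitions_def)
  next
    \<comment> \<open>If \<open>b\<close> meets a block of \<open>bs\<close>, both sides of the
      equivalence fail.\<close>
    case False
    have "\<exists>c\<in>set bs. \<not> disjnt b c"
      using False by (simp add: disjnt_Union2)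
    then have "b \<in> set bs \<or> \<not> disjoint (insert b (set bs))"
      by (auto simp: pairwise_insert)
    then have "b # bs \<notin> ?L"
      by (auto simp: ordered_partitions_def partition_on_def)
    moreover have "bs \<notin> ordered_partitions (A - b) k"
      using False by (auto simp: ordered_partitions_def partition_on_def disjnt_def)
    ultimately show ?thesis by blast
  qed
  show ?thesis
  proof (intro equalityI subsetI)
    fix ds assume ds: "ds \<in> ?L"
    then obtain b bs where "ds = b # bs"
      by (cases ds) (auto simp: ordered_partitions_def)
    then show "ds \<in> ?R"
      using ds iff[of b bs] by (simp add: image_iff)
  next
    fix ds assume "ds \<in> ?R"
    then obtain b bs where "ds = b # bs" "b \<in> Pow A - {{}}" "bs \<in> ordered_partitions (A - b) k"
      by (elim imageE SigmaE) auto
    then show "ds \<in> ?L"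
      using iff[of b bs] by simp
  qed
qed

lemma finite_ordered_partitions:
  assumes "finite A"
  shows "finite (ordered_partitions A k)"
proof (rule finite_subset)
  show "ordered_partitions A k \<subseteq> {bs. set bs \<subseteq> Pow A \<and> length bs = k}"
    unfolding ordered_partitions_def partition_on_def by blast
  show "finite {bs. set bs \<subseteq> Pow A \<and> length bs = k}"
    using assms by (intro finite_lists_length_eq) auto
qed

lemma sum_Pow_card:
  fixes h :: "nat \<Rightarrow> 'b :: comm_semiring_1"
  assumes "finite A"
  shows "(\<Sum>b\<in>Pow A. h (card b)) = (\<Sum>j\<le>card A. of_nat (card A choose j) * h j)"
proof -
  have "(\<Sum>b\<in>Pow A. h (card b)) = (\<Sum>j\<le>card A. \<Sum>b\<in>{b \<in> Pow A. card b = j}. h (card b))"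
    using assms by (intro sum.group[symmetric]) (auto intro: card_mono)
  also have "\<dots> = (\<Sum>j\<le>card A. of_nat (card A choose j) * h j)"
    using assms by (intro sum.cong refl) (simp add: n_subsets)
  finally show ?thesis .
qed

text \<open>Choosing a nonempty first block is, for exponential generating functions, multiplication
  by \<open>fps_exp 1 - 1\<close>.\<close>

lemma card_ordered_partitions:
  assumes "finite A"
  shows "of_nat (card (ordered_partitions A k)) =
    (fact (card A) * fps_nth ((fps_exp 1 - 1) ^ k) (card A) :: rat)" (is "_ = _ * fps_nth (?E ^ k) _")
  using assms
proof (induction k arbitrary: A)
  case 0
  then show ?case by (simp add: ordered_partitions_0)
next
  case (Suc k)
  let ?n = "card A"
  \<comment> \<open>The value 0 at \<open>j = 0\<close> matches the vanishing constant term of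
    \<open>?E\<close> and lets the sum run over all subsets, including the empty one.\<close>
  define h where "h j = (if j = 0 then 0 else fact (?n - j) * fps_nth (?E ^ k) (?n - j))" for j
  have "card (ordered_partitions A (Suc k)) = (\<Sum>b\<in>Pow A - {{}}. card (ordered_partitions (A - b) k))"
    using Suc.prems unfolding ordered_partitions_Suc
    by (subst card_image) (auto simp: inj_on_def finite_ordered_partitions)
  also have "of_nat \<dots> = (\<Sum>b\<in>Pow A - {{}}. h (card b))"
    unfolding of_nat_sum
  proof (intro sum.cong refl)
    fix b assume b: "b \<in> Pow A - {{}}"
    then have "finite b" using Suc.prems by (auto intro: finite_subset)
    then show "of_nat (card (ordered_partitions (A - b) k)) = h (card b)"
      using b Suc by (simp add: h_def card_Diff_subset)
  qed
  also have "\<dots> = (\<Sum>b\<in>Pow A. h (card b))"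
    using Suc.prems by (intro sum.mono_neutral_left) (auto simp: h_def)
  also have "\<dots> = (\<Sum>j\<le>?n. of_nat (?n choose j) * h j)"
    by (rule sum_Pow_card) fact
  also have "\<dots> = (\<Sum>j\<le>?n. fact ?n * (fps_nth ?E j * fps_nth (?E ^ k) (?n - j)))"
    by (intro sum.cong refl) (auto simp: h_def binomial_fact)
  also have "\<dots> = fact ?n * fps_nth (?E ^ Suc k) ?n"
    by (simp add: fps_mult_nth sum_distrib_left atLeast0AtMost)
  finally show ?case .
qed

text \<open>Once the lengths of the pieces are prescribed, a flat list can be cut in exactly one
  way.\<close>

lemma bij_betw_concat_map_length:
  "bij_betw concat {ps. map length ps = L} {bs. length bs = sum_list L}"
proof (intro bij_betw_imageI inj_onI)
  fix ps qs :: "'a list list"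
  assume ps: "ps \<in> {ps. map length ps = L}" and qs: "qs \<in> {ps. map length ps = L}"
    and eq: "concat ps = concat qs"
  have len: "map length ps = map length qs"
    using ps qs by simp
  show "ps = qs"
  proof (rule concat_injective[OF eq])
    show "length ps = length qs"
      using len by (rule map_eq_imp_length_eq)
    show "\<forall>(x, y)\<in>set (zip ps qs). length x = length y"
      using len by (auto simp: set_zip) (metis nth_map)
  qed
next
  show "concat ` {ps. map length ps = L} = {bs :: 'a list. length bs = sum_list L}"
  proof (induction L)
    case (Cons l L)
    show ?case
    proof (intro equalityI subsetI)
      fix bs :: "'a list"
      assume bs: "bs \<in> {bs. length bs = sum_list (l # L)}"
      then have "drop l bs \<in> concat ` {ps. map length ps = L}"
        unfolding Cons by simp
      then obtain ps where "map length ps = L" "concat ps = drop l bs"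
        by auto
      then have "map length (take l bs # ps) = l # L" "concat (take l bs # ps) = bs"
        using bs by auto
      then show "bs \<in> concat ` {ps. map length ps = l # L}"
        by (metis (mono_tags) imageI mem_Collect_eq)
    qed (auto simp: length_concat)
  qed auto
qed

text \<open>The reciprocals of the fibre size add up to 1 over each fibre. This counts matrices by
  summing over their many representations.\<close>

lemma sum_image_fibres:
  assumes "finite X"
  shows "of_nat (card (f ` X)) = (\<Sum>x\<in>X. 1 / of_nat (card {y \<in> X. f y = f x}) :: 'b :: field_char_0)"
proof -
  have "(\<Sum>x\<in>X. 1 / of_nat (card {y \<in> X. f y = f x}) :: 'b) =
      (\<Sum>z\<in>f ` X. \<Sum>x\<in>{x \<in> X. f x = z}. 1 / of_nat (card {y \<in> X. f y = f x}))"
    using assms by (rule sum.image_gen)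
  also have "\<dots> = (\<Sum>z\<in>f ` X. 1)"
  proof (intro sum.cong refl)
    fix z assume "z \<in> f ` X"
    then have "{x \<in> X. f x = z} \<noteq> {}" by auto
    then have "card {x \<in> X. f x = z} \<noteq> 0"
      using assms by simp
    then show "(\<Sum>x\<in>{x \<in> X. f x = z}. 1 / of_nat (card {y \<in> X. f y = f x})) = (1 :: 'b)"
      by simp
  qed
  finally show ?thesis by simp
qed

section \<open>The generating function of path systems\<close>

text \<open>The index \<open>l\<close> is one more than the number of blocks of the path, to count the gap after it.\<close>

definition path_weight :: "nat \<Rightarrow> rat" where
  "path_weight l = (if l < 2 then 0 else if l = 2 then 1 else 1 / 2)"

text \<open>The coefficient of \<open>y^l\<close> accounts for a path with \<open>l - 1\<close>
  blocks. At \<open>l = 0\<close>, where the subtraction truncates, the weight vanishes.\<close>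

definition path_series :: fps_xy where
  "path_series = Abs_fps (\<lambda>l. fps_const (path_weight l) * (fps_exp 1 - 1) ^ (l - 1))"

lemma path_series_power_nth:
  "fps_nth (path_series ^ c) N = (\<Sum>v\<in>natpermute N c.
    fps_const (\<Prod>l\<leftarrow>v. path_weight l) * (fps_exp 1 - 1) ^ (N - c))"
proof (cases "c = 0")
  case True
  then show ?thesis by (simp add: natpermute_0)
next
  case False
  \<comment> \<open>If all parts are at least 2, the subtraction is exact and the exponents
    \<open>l - 1\<close> add up; otherwise both sides are 0.\<close>
  have prod: "(\<Prod>l\<leftarrow>v. fps_nth path_series l) =
      fps_const (\<Prod>l\<leftarrow>v. path_weight l) * (fps_exp 1 - 1) ^ (sum_list v - length v)" for v
  proof (cases "\<forall>l\<in>set v. 2 \<le> l")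
    case True
    then show ?thesis
    proof (induction v)
      case (Cons l v)
      have "length v \<le> sum_list v"
        using Cons.prems sum_list_mono[of v "\<lambda>_. 1" "\<lambda>l. l"] by (force simp: sum_list_triv)
      then obtain d where d: "sum_list v = length v + d"
        using le_iff_add by blast
      obtain k where k: "l = Suc k"
        using Cons.prems by (cases l) auto
      show ?case
        using Cons unfolding d k
        by (simp add: d path_series_def power_add mult_ac flip: fps_const_mult)
    qed simp
  next
    case False
    then obtain l where l: "l \<in> set v" "l < 2" by auto
    have "fps_nth path_series l = 0" "path_weight l = 0"
      using l(2) by (auto simp: path_series_def path_weight_def)
    then have "(\<Prod>l\<leftarrow>v. fps_nth path_series l) = 0" "(\<Prod>l\<leftarrow>v. path_weight l) = 0"
      using l(1) by (force simp: prod_list_zero_iff)+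
    then show ?thesis by simp
  qed
  have "fps_nth (path_series ^ c) N =
      (\<Sum>v\<in>natpermute N c. \<Prod>j\<in>{0..c - 1}. fps_nth path_series (v ! j))"
    using False by (simp add: fps_power_nth)
  also have "\<dots> = (\<Sum>v\<in>natpermute N c. \<Prod>l\<leftarrow>v. fps_nth path_series l)"
  proof (intro sum.cong refl)
    fix v assume "v \<in> natpermute N c"
    then have "{0..c - 1} = {0..<length v}"
      using False by (cases c) (auto simp: natpermute_def)
    then show "(\<Prod>j\<in>{0..c - 1}. fps_nth path_series (v ! j)) = (\<Prod>l\<leftarrow>v. fps_nth path_series l)"
      by (simp add: prod.list_conv_set_nth)
  qed
  also have "\<dots> = (\<Sum>v\<in>natpermute N c.
      fps_const (\<Prod>l\<leftarrow>v. path_weight l) * (fps_exp 1 - 1) ^ (N - c))"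
    unfolding prod by (intro sum.cong refl) (auto simp: natpermute_def)
  finally show ?thesis .
qed

text \<open>With \<open>u\<close> for \<open>var_y * (exp_x - 1)\<close>, the geometric series plus
  \<open>u\<close> minus 1 has coefficient 2 at \<open>u\<close> and 1 at each higher power. The
  factor \<open>var_y / 2\<close> turns these into the weights 1 and 1/2 and raises the degree in
  \<open>y\<close> by one.\<close>

lemma path_series_eq:
  "var_y / 2 * (1 / (1 - var_y * (exp_x - 1)) + var_y * (exp_x - 1) - 1) = path_series"
proof -
  let ?u = "var_y * (exp_x - 1)"
  define E :: "rat fps" where "E = fps_exp 1 - 1"
  define G where "G = Abs_fps (\<lambda>l. E ^ l)"
  have u: "?u = fps_X * fps_const E"
    by (simp add: var_y_def exp_x_def E_def flip: fps_const_1_eq_1 fps_const_sub)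
  have G: "(1 - ?u) * G = 1"
  proof (rule fps_ext)
    fix l
    have "(1 - ?u) * G = G - fps_X * (fps_const E * G)"
      unfolding u by (simp add: algebra_simps)
    also have "fps_nth \<dots> l = fps_nth 1 l"
      by (cases l) (simp_all add: G_def)
    finally show "fps_nth ((1 - ?u) * G) l = fps_nth 1 l" .
  qed
  \<comment> \<open>The coefficients do not form a field, so the quotient is identified through its
    product with \<open>1 - ?u\<close>, which \<open>geometric_times\<close> provides.\<close>
  have "1 / (1 - ?u) = ((1 - ?u) * G) * (1 / (1 - ?u))"
    unfolding G by simp
  also have "\<dots> = ((1 - ?u) * (1 / (1 - ?u))) * G"
    by (simp only: ac_simps)
  finally have inv: "1 / (1 - ?u) = G"
    unfolding geometric_times by simp
  have "2 * (var_y / 2 * (1 / (1 - ?u) + ?u - 1)) = var_y * (G + ?u - 1)"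
    unfolding inv mult.assoc[symmetric] two_times_half_var_y ..
  also have "\<dots> = 2 * path_series"
  proof (rule fps_ext)
    fix l
    have two: "(2 :: fps_xy) = fps_const 2" "(2 :: rat fps) = fps_const 2"
      by (simp_all add: numeral_fps_const)
    have half: "fps_const 2 * (fps_const (1 / 2) * f) = f" for f :: "rat fps"
      by (simp add: mult.assoc[symmetric])
    consider "l = 0" | "l = 1" | "l = 2" | k where "l = Suc (Suc (Suc k))"
      by (metis One_nat_def Suc_1 not0_implies_Suc)
    then show "fps_nth (var_y * (G + ?u - 1)) l = fps_nth (2 * path_series) l"
      unfolding u
      by cases (simp_all add: var_y_def G_def path_series_def path_weight_def two half flip: E_def del: fps_const_mult)
  qed
  finally show ?thesis by simp
qed

text \<open>Here \<open>c\<close> is the number of paths, \<open>v\<close> lists their numbers of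
  blocks plus one, and \<open>N - c\<close> is the total number of blocks.\<close>

lemma exp_y_path_series_nth:
  "fps_nth (fps_nth (exp_y path_series) N) m = (\<Sum>c\<le>N. \<Sum>v\<in>natpermute N c.
    (\<Prod>l\<leftarrow>v. path_weight l) / fact c * fps_nth ((fps_exp 1 - 1) ^ (N - c)) m)"
proof -
  have fact: "(1 / fact c :: rat fps) = fps_const (1 / fact c)" for c
  proof -
    have "(fact c :: rat fps) = fps_const (fact c)"
      by (metis fps_of_nat of_nat_fact)
    then show ?thesis
      by (simp add: fps_const_divide[symmetric])
  qed
  show ?thesis
    unfolding exp_y_def fps_compose_nth path_series_power_nth
    by (simp add: fact fps_sum_nth sum_distrib_left atLeast0AtMost mult_ac)
qed

section \<open>Path systems and Bott--Samelson matrices\<close>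

definition link_matrix :: "nat \<Rightarrow> (nat \<times> nat) set \<Rightarrow> (nat \<times> nat) set \<Rightarrow> int mat" where
  "link_matrix m S R =
     mat m m (\<lambda>(j, k).
       if j < k then 0
       else if j = k then -1
       else if (j, k) \<in> S then -2
       else if (j, k) \<in> R then 1
       else 0)"

definition system_matrix :: "nat \<Rightarrow> nat set list list \<Rightarrow> int mat" where
  "system_matrix m ps = link_matrix m (same_block (set (concat ps))) (linked ps)"

definition system_size :: "'a set list list \<Rightarrow> nat" where
  "system_size ps = (\<Sum>p\<leftarrow>ps. Suc (length p))"

lemma system_size_conv_length: "system_size ps = length (concat ps) + length ps"
  by (induction ps) (auto simp: system_size_def)

text \<open>The list \<open>B\<close> holds the level sets of \<open>s\<close> by value, empty ones
  included, so neighbouring positions of \<open>B\<close> are consecutive values.\<close>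

lemma bott_samelson_matrix_eq_link_matrix:
  assumes s: "s \<in> seqs n m"
    and B: "length B = n" "\<And>a. a < n \<Longrightarrow> B ! a = {i. i < m \<and> s ! i = Suc a}"
  shows "bott_samelson_matrix s = link_matrix m (same_block (set B)) (links B)"
proof -
  have len: "length s = m"
    using s by (simp add: seqs_def)
  have mem: "i \<in> B ! a \<longleftrightarrow> s ! i = Suc a" if "i < m" "a < n" for i a
    using that B by simp
  have val: "\<exists>a<n. s ! i = Suc a" if "i < m" for i
  proof -
    have "s ! i \<in> {1..n}"
      using s that nth_mem[of i s] unfolding seqs_def by blast
    then show ?thesis by (cases "s ! i") auto
  qed
  have same: "(i, j) \<in> same_block (set B) \<longleftrightarrow> s ! i = s ! j" if ij: "i < m" "j < m" for i j
  proof -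
    have "(i, j) \<in> same_block (set B) \<longleftrightarrow> (\<exists>a<n. i \<in> B ! a \<and> j \<in> B ! a)"
      using B(1) by (auto simp: same_block_def set_conv_nth)
    also have "\<dots> \<longleftrightarrow> s ! i = s ! j"
      using mem[OF ij(1)] mem[OF ij(2)] val[OF ij(1)] by metis
    finally show ?thesis .
  qed
  have link: "(i, j) \<in> links B \<longleftrightarrow> \<bar>int (s ! i) - int (s ! j)\<bar> = 1" if ij: "i < m" "j < m" for i j
  proof -
    have "(i, j) \<in> links B \<longleftrightarrow>
        (\<exists>a c. a < n \<and> c < n \<and> (c = Suc a \<or> a = Suc c) \<and> s ! i = Suc a \<and> s ! j = Suc c)"
      unfolding mem_links_iff B(1) using mem ij by blast
    also have "\<dots> \<longleftrightarrow> s ! j = Suc (s ! i) \<or> s ! i = Suc (s ! j)"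
    proof -
      obtain a c where "a < n" "s ! i = Suc a" "c < n" "s ! j = Suc c"
        using val[OF ij(1)] val[OF ij(2)] by blast
      then show ?thesis by auto
    qed
    also have "\<dots> \<longleftrightarrow> \<bar>int (s ! i) - int (s ! j)\<bar> = 1"
      by linarith
    finally show ?thesis .
  qed
  show ?thesis
    unfolding bott_samelson_matrix_def link_matrix_def len
    by (rule cong_mat) (use same link in auto)
qed

lemma ex_path_system_of_blocks:
  "\<exists>ps. [] \<notin> set ps \<and> concat ps = filter (\<lambda>b. b \<noteq> {}) B \<and> linked ps = links B \<and>
    system_size ps \<le> Suc (length B)"
proof (induction "length B" arbitrary: B rule: less_induct)
  case less
  show ?case
  proof (cases "{} \<in> set B")
    case False
    then have "filter (\<lambda>b. b \<noteq> {}) B = B"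
      by (metis (mono_tags, lifting) filter_True)
    then show ?thesis
      by (intro exI[of _ "if B = [] then [] else [B]"]) (auto simp: linked_def system_size_def)
  next
    case True
    then obtain p B' where B: "B = p @ {} # B'" "{} \<notin> set p"
      by (metis split_list_first)
    then have p: "filter (\<lambda>b. b \<noteq> {}) p = p"
      by (metis (mono_tags, lifting) filter_True)
    obtain ps where ps: "[] \<notin> set ps" "concat ps = filter (\<lambda>b. b \<noteq> {}) B'"
      "linked ps = links B'" "system_size ps \<le> Suc (length B')"
      using less[of B'] B by auto
    show ?thesis
      using ps p unfolding B(1) links_append_empty
      by (intro exI[of _ "if p = [] then ps else p # ps"]) (auto simp: linked_def system_size_def)
  qed
qed

lemma links_blank_separated:
  "links (concat (map (\<lambda>p. p @ [{}]) ps) @ replicate k {}) = linked ps"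
proof (induction ps)
  case Nil
  have "links (replicate k {}) = {}"
    using links_append_empty[of "[]"] by (induction k) auto
  then show ?case by (simp add: linked_def)
next
  case (Cons p ps)
  then show ?case by (simp add: links_append_empty linked_def)
qed

text \<open>Needed for a list of level sets, where the empty set may repeat but a nonempty block may
  not.\<close>

lemma distinct_filter_nth_eq:
  assumes "distinct (filter P xs)" "a < length xs" "c < length xs" "xs ! a = xs ! c" "P (xs ! a)"
  shows "a = c"
proof -
  have False if "distinct (filter P xs)" "a < c" "c < length xs" "xs ! a = xs ! c" "P (xs ! a)" for a c
  proof -
    have xs: "xs = take c xs @ xs ! c # drop (Suc c) xs"
      using that by (simp add: id_take_nth_drop[symmetric])
    have "xs ! a \<in> set (filter P (take c xs))"
      using that by (auto simp: in_set_conv_nth)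
    moreover have "distinct (filter P (take c xs) @ filter P (xs ! c # drop (Suc c) xs))"
      using that(1) xs by (metis filter_append)
    ultimately show False
      using that by auto
  qed
  then show ?thesis
    using assms by (metis linorder_neqE_nat)
qed

lemma bott_samelson_matrices_eq:
  "bott_samelson_matrix ` seqs n m =
    system_matrix m ` {ps \<in> path_systems {..<m}. system_size ps \<le> Suc n}" (is "?L = ?R")
proof (intro equalityI subsetI)
  fix M assume "M \<in> ?L"
  then obtain s where s: "s \<in> seqs n m" "M = bott_samelson_matrix s" by blast
  define B where "B = map (\<lambda>a. {i. i < m \<and> s ! i = Suc a}) [0..<n]"
  have B: "length B = n" "\<And>a. a < n \<Longrightarrow> B ! a = {i. i < m \<and> s ! i = Suc a}"
    by (auto simp: B_def)
  obtain ps where ps: "[] \<notin> set ps" "concat ps = filter (\<lambda>b. b \<noteq> {}) B"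
    "linked ps = links B" "system_size ps \<le> Suc n"
    using ex_path_system_of_blocks[of B] B(1) by auto
  have "distinct (filter (\<lambda>b. b \<noteq> {}) B)"
    unfolding B_def filter_map distinct_map by (intro conjI inj_onI) fastforce+
  moreover have "partition_on {..<m} (set (filter (\<lambda>b. b \<noteq> {}) B))"
  proof (rule partition_onI)
    have "\<exists>a<n. s ! i = Suc a" if "i < m" for i
    proof -
      have "s ! i \<in> {1..n}"
        using s(1) that nth_mem[of i s] unfolding seqs_def by blast
      then show ?thesis by (cases "s ! i") auto
    qed
    then show "\<Union>(set (filter (\<lambda>b. b \<noteq> {}) B)) = {..<m}"
      by (fastforce simp: B_def)
  qed (auto simp: B_def disjnt_def)
  ultimately have "ps \<in> path_systems {..<m}"
    using ps(1,2) by (simp add: path_systems_def del: set_concat)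
  moreover have "same_block (set (concat ps)) = same_block (set B)"
    unfolding ps(2) by (auto simp: same_block_def)
  then have "M = system_matrix m ps"
    using bott_samelson_matrix_eq_link_matrix[OF s(1) B] s(2) ps(3) by (simp add: system_matrix_def)
  ultimately show "M \<in> ?R"
    using ps(4) by blast
next
  fix M assume "M \<in> ?R"
  then obtain ps where ps: "ps \<in> path_systems {..<m}" "system_size ps \<le> Suc n" "M = system_matrix m ps"
    by blast
  \<comment> \<open>Every path is followed by an empty block, so \<open>B0\<close> has
    \<open>n + 1\<close> entries. Its last entry is empty and is dropped to obtain
    \<open>B\<close>.\<close>
  define B0 where "B0 = concat (map (\<lambda>p. p @ [{}]) ps) @ replicate (Suc n - system_size ps) {}"
  have len: "length B0 = Suc n"
    using ps(2) unfolding B0_def by (simp add: system_size_def length_concat comp_def)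
  have "B0 \<noteq> []"
    using len by auto
  then have B0: "B0 = butlast B0 @ [last B0]" by simp
  have "last B0 = {}"
  proof (cases "Suc n - system_size ps")
    case 0
    then have "B0 = concat (map (\<lambda>p. p @ [{}]) ps)" by (simp add: B0_def)
    then show ?thesis
      using \<open>B0 \<noteq> []\<close> by (cases ps rule: rev_cases) auto
  qed (simp add: B0_def)
  define B where "B = butlast B0"
  have B: "B0 = B @ {} # []" "length B = n"
    using B0 \<open>last B0 = {}\<close> len by (auto simp: B_def)
  have "links B0 = linked ps"
    unfolding B0_def by (rule links_blank_separated)
  then have links: "links B = linked ps"
    unfolding B(1) links_append_empty by simp
  have nonempty: "\<forall>b\<in>set (concat ps). b \<noteq> {}" and part: "partition_on {..<m} (set (concat ps))"
    and dist: "distinct (concat ps)"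
    using ps(1) unfolding path_systems_def partition_on_def by blast+
  have "filter (\<lambda>b. b \<noteq> {}) (concat (map (\<lambda>p. p @ [{}]) ps)) = concat ps"
    using nonempty by (induction ps) auto
  then have filt: "filter (\<lambda>b. b \<noteq> {}) B = concat ps"
    using arg_cong[OF B(1), of "filter (\<lambda>b. b \<noteq> {})"] unfolding B0_def by simp
  have uniq: "a = c" if "a < n" "c < n" "i \<in> B ! a" "i \<in> B ! c" for a c i
  proof -
    have "B ! a \<in> set (concat ps)" "B ! c \<in> set (concat ps)"
      using that B(2) unfolding filt[symmetric] by auto
    then have "B ! a = B ! c"
      using partition_onD2[OF part] that(3,4) unfolding disjoint_def by blast
    then show ?thesis
      using distinct_filter_nth_eq[of "\<lambda>b. b \<noteq> {}" B a c] dist filt that B(2) by auto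
  qed
  have cover: "i < m \<longleftrightarrow> (\<exists>a<n. i \<in> B ! a)" for i
  proof -
    have "i < m \<longleftrightarrow> (\<exists>b\<in>set (filter (\<lambda>b. b \<noteq> {}) B). i \<in> b)"
      unfolding filt using partition_onD1[OF part] by blast
    also have "\<dots> \<longleftrightarrow> (\<exists>a<n. i \<in> B ! a)"
      using B(2) by (auto simp: in_set_conv_nth)
    finally show ?thesis .
  qed
  \<comment> \<open>The position of the block that contains \<open>i\<close>, unique by
    \<open>uniq\<close>; the value of the sequence is one more, since values start at 1.\<close>
  define idx where "idx i = (SOME a. a < n \<and> i \<in> B ! a)" for i
  have idx: "idx i < n" "i \<in> B ! idx i" if "i < m" for i
    using cover[of i] that someI_ex[of "\<lambda>a. a < n \<and> i \<in> B ! a"] unfolding idx_def by auto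
  define s where "s = map (\<lambda>i. Suc (idx i)) [0..<m]"
  have s: "s \<in> seqs n m"
    using idx(1) by (auto simp: s_def seqs_def Suc_le_eq)
  have blocks: "B ! a = {i. i < m \<and> s ! i = Suc a}" if a: "a < n" for a
  proof (intro equalityI subsetI)
    fix i assume i: "i \<in> B ! a"
    then have "i < m" using cover a by blast
    then show "i \<in> {i. i < m \<and> s ! i = Suc a}"
      using uniq[OF idx(1) a idx(2) i] by (simp add: s_def)
  next
    fix i assume "i \<in> {i. i < m \<and> s ! i = Suc a}"
    then show "i \<in> B ! a"
      using idx(2)[of i] by (auto simp: s_def)
  qed
  have "same_block (set (concat ps)) = same_block (set B)"
    unfolding filt[symmetric] by (auto simp: same_block_def)
  then have "M = bott_samelson_matrix s"
    using bott_samelson_matrix_eq_link_matrix[OF s B(2) blocks] ps(3) links by (simp add: system_matrix_def)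
  then show "M \<in> ?L"
    using s by blast
qed

section \<open>Recovering the relations from the matrix\<close>

lemma sym_linked: "(i, j) \<in> linked ps \<longleftrightarrow> (j, i) \<in> linked ps"
  unfolding linked_def UN_iff mem_links_iff by blast

text \<open>Consecutive blocks of a path are different, hence disjoint. So the entries -2 and 1
  never compete for a position, and the matrix reveals both relations.\<close>

lemma path_systems_linked_not_same_block:
  assumes ps: "ps \<in> path_systems A" and ij: "(i, j) \<in> linked ps"
  shows "(i, j) \<notin> same_block (set (concat ps))" "i \<in> A" "j \<in> A"
proof -
  have part: "partition_on A (set (concat ps))" and dist: "distinct (concat ps)"
    using ps unfolding path_systems_def by blast+
  obtain p a c where p: "p \<in> set ps" "a < length p" "c < length p" "c = Suc a \<or> a = Suc c"
    "i \<in> p ! a" "j \<in> p ! c"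
    using ij unfolding linked_def UN_iff mem_links_iff by blast
  have mem: "p ! a \<in> set (concat ps)" "p ! c \<in> set (concat ps)"
    using p(1) nth_mem[OF p(2)] nth_mem[OF p(3)] by auto
  then show "i \<in> A" "j \<in> A"
    using partition_onD1[OF part] p(5,6) by blast+
  show "(i, j) \<notin> same_block (set (concat ps))"
  proof
    assume "(i, j) \<in> same_block (set (concat ps))"
    then obtain b where b: "b \<in> set (concat ps)" "i \<in> b" "j \<in> b"
      unfolding same_block_def by blast
    then have "p ! a = b" "p ! c = b"
      using disjointD[OF partition_onD2[OF part] mem(1) b(1)]
        disjointD[OF partition_onD2[OF part] mem(2) b(1)] p(5,6) by blast+
    then have "p ! a = p ! c" by simp
    moreover have "distinct p"
      using dist p(1) by (simp add: distinct_concat_iff)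
    ultimately show False
      using p(2-4) by (auto simp: nth_eq_iff_index_eq)
  qed
qed

text \<open>The entries below the diagonal determine both relations there, symmetry carries them
  above it, and on the diagonal both are forced.\<close>

lemma system_matrix_eq_iff:
  assumes ps: "ps \<in> path_systems {..<m}" and qs: "qs \<in> path_systems {..<m}"
  shows "system_matrix m ps = system_matrix m qs \<longleftrightarrow>
    same_block (set (concat ps)) = same_block (set (concat qs)) \<and> linked ps = linked qs"
proof
  assume eq: "system_matrix m ps = system_matrix m qs"
  have entry: "system_matrix m ps $$ (i, j) = (if (i, j) \<in> same_block (set (concat ps)) then -2
      else if (i, j) \<in> linked ps then 1 else 0)" if "j < i" "i < m" for i j ps
    using that by (simp add: system_matrix_def link_matrix_def)
  have below: "((i, j) \<in> same_block (set (concat ps)) \<longleftrightarrow> (i, j) \<in> same_block (set (concat qs))) \<and>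
      ((i, j) \<in> linked ps \<longleftrightarrow> (i, j) \<in> linked qs)" if ij: "j < i" "i < m" for i j
    using entry[OF ij, of ps] entry[OF ij, of qs] eq
      path_systems_linked_not_same_block(1)[OF ps, of i j]
      path_systems_linked_not_same_block(1)[OF qs, of i j]
    by (auto split: if_splits)
  have sym: "(i, j) \<in> same_block P \<longleftrightarrow> (j, i) \<in> same_block P" for i j :: nat and P
    by (auto simp: same_block_def)
  have diag: "(i, i) \<in> same_block (set (concat rs)) \<and> (i, i) \<notin> linked rs"
    if rs: "rs \<in> path_systems {..<m}" and i: "i < m" for rs i
  proof -
    have "partition_on {..<m} (set (concat rs))"
      using rs unfolding path_systems_def by blast
    then have "(i, i) \<in> same_block (set (concat rs))"
      using i partition_onD1 unfolding same_block_def by blast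
    then show ?thesis
      using path_systems_linked_not_same_block(1)[OF rs] by blast
  qed
  have all: "((i, j) \<in> same_block (set (concat ps)) \<longleftrightarrow> (i, j) \<in> same_block (set (concat qs))) \<and>
      ((i, j) \<in> linked ps \<longleftrightarrow> (i, j) \<in> linked qs)" if "i < m" "j < m" for i j
  proof -
    consider "j < i" | "i = j" | "i < j" by linarith
    then show ?thesis
    proof cases
      case 1
      then show ?thesis using below that by blast
    next
      case 2
      then show ?thesis using diag[OF ps] diag[OF qs] that by blast
    next
      case 3
      then show ?thesis
        using below[of i j] that sym[of i j] sym_linked[of i j ps] sym_linked[of i j qs] by blast
    qed
  qed
  have dom: "i < m \<and> j < m"
    if rs: "rs \<in> path_systems {..<m}" and ij: "(i, j) \<in> same_block (set (concat rs)) \<union> linked rs" for rs i j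
  proof (cases "(i, j) \<in> linked rs")
    case True
    then show ?thesis
      using path_systems_linked_not_same_block(2,3)[OF rs] by blast
  next
    case False
    have "partition_on {..<m} (set (concat rs))"
      using rs unfolding path_systems_def by blast
    then have "{..<m} = \<Union>(set (concat rs))"
      by (rule partition_onD1)
    then show ?thesis
      using False ij unfolding same_block_def by blast
  qed
  show "same_block (set (concat ps)) = same_block (set (concat qs)) \<and> linked ps = linked qs"
    by (intro conjI equalityI subrelI; use all dom[OF ps] dom[OF qs] in blast)
qed (simp add: system_matrix_def)

text \<open>The relations fix both the blocks and the number of paths. A size bound therefore keeps
  or discards all representations of a matrix together.\<close>

lemma system_size_cong:
  assumes ps: "ps \<in> path_systems A" and qs: "qs \<in> path_systems A"
    and "same_block (set (concat ps)) = same_block (set (concat qs))" "linked ps = linked qs"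
  shows "system_size ps = system_size qs"
proof -
  have "map unoriented ps \<in> permutations_of_set (unoriented ` set qs)"
    using path_systems_same_relations[OF qs] assms by blast
  then have im: "unoriented ` set ps = unoriented ` set qs"
    by (auto simp: permutations_of_set_def)
  have len: "length rs = card (unoriented ` set rs)" if "rs \<in> path_systems A" for rs
    using card_image[OF path_systems_inj_unoriented[OF that]]
      distinct_card[OF path_systems_distinct[OF that]] by simp
  have "set (concat ps) = set (concat qs)"
    using image_eq_if_unoriented_image_eq[OF im, of set] by simp
  then have "length (concat ps) = length (concat qs)"
    using ps qs distinct_card unfolding path_systems_def mem_Collect_eq by metis
  then show ?thesis
    using len[OF ps] len[OF qs] im by (simp add: system_size_conv_length)
qed

lemma card_system_matrix_fibre:
  assumes ps: "ps \<in> path_systems {..<m}" "system_size ps \<le> k"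
  shows "card {qs \<in> {qs \<in> path_systems {..<m}. system_size qs \<le> k}. system_matrix m qs = system_matrix m ps} =
    fact (length ps) * (\<Prod>p\<leftarrow>ps. if length p = 1 then 1 else 2)"
proof -
  have "{qs \<in> {qs \<in> path_systems {..<m}. system_size qs \<le> k}. system_matrix m qs = system_matrix m ps} =
    {qs \<in> path_systems {..<m}. same_block (set (concat qs)) = same_block (set (concat ps)) \<and>
      linked qs = linked ps}"
    using ps(2) system_matrix_eq_iff[OF _ ps(1)] system_size_cong[OF _ ps(1)]
    by (intro Collect_cong) (metis (no_types, lifting) mem_Collect_eq)
  then show ?thesis
    using card_path_systems_same_relations[OF ps(1)] by simp
qed

section \<open>Counting the matrices\<close>

definition path_sizes :: "'a set list list \<Rightarrow> nat list" where
  "path_sizes ps = map (\<lambda>p. Suc (length p)) ps"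

text \<open>With the path lengths prescribed, concatenation is a bijection onto ordered partitions,
  so only the total number of blocks matters. A part below 2 would call for an empty path.\<close>

lemma card_path_systems_path_sizes:
  "card {ps \<in> path_systems A. path_sizes ps = v} =
    (if \<forall>l\<in>set v. 2 \<le> l then card (ordered_partitions A (sum_list v - length v)) else 0)"
proof (cases "\<forall>l\<in>set v. 2 \<le> l")
  case True
  define L where "L = map (\<lambda>l. l - 1) v"
  have v: "v = map Suc L"
    unfolding L_def map_map by (rule map_idI[symmetric]) (use True in force)
  have "sum_list (map Suc L) = sum_list L + length L"
    by (induction L) auto
  then have size: "sum_list L = sum_list v - length v"
    by (simp add: v)
  have "0 \<notin> set L"
    using True by (auto simp: L_def)
  have "path_sizes ps = v \<longleftrightarrow> map length ps = L" for ps :: "'a set list list"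
  proof -
    have "path_sizes ps = map Suc (map length ps)"
      by (simp add: path_sizes_def)
    then show ?thesis
      unfolding v by (simp only: inj_map_eq_map[OF inj_Suc])
  qed
  moreover have "[] \<notin> set ps" if "map length ps = L" for ps :: "'a set list list"
    using \<open>0 \<notin> set L\<close> that by (metis image_eqI length_0_conv list.set_map)
  ultimately have eq: "{ps \<in> path_systems A. path_sizes ps = v} =
      {ps \<in> {ps. map length ps = L}. distinct (concat ps) \<and> partition_on A (set (concat ps))}"
    unfolding path_systems_def by blast
  have bij: "bij_betw concat {ps. map length ps = L} {bs :: 'a set list. length bs = sum_list L}"
    by (rule bij_betw_concat_map_length)
  have "bij_betw concat {ps \<in> path_systems A. path_sizes ps = v}
      (ordered_partitions A (sum_list L))"
  proof (rule bij_betw_subset[OF bij])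
    show "{ps \<in> path_systems A. path_sizes ps = v} \<subseteq> {ps. map length ps = L}"
      unfolding eq by blast
    have "ordered_partitions A (sum_list L) =
        {bs \<in> concat ` {ps. map length ps = L}. distinct bs \<and> partition_on A (set bs)}"
      unfolding bij_betw_imp_surj_on[OF bij] by (simp add: ordered_partitions_def conj_commute conj_left_commute)
    then show "concat ` {ps \<in> path_systems A. path_sizes ps = v} = ordered_partitions A (sum_list L)"
      unfolding eq by (simp only: Compr_image_eq)
  qed
  then show ?thesis
    using True by (simp add: bij_betw_same_card size)
next
  case False
  then obtain l where l: "l \<in> set v" "l < 2" by auto
  have "path_sizes ps \<noteq> v" if "ps \<in> path_systems A" for ps
  proof
    assume "path_sizes ps = v"
    then obtain p where "p \<in> set ps" "l = Suc (length p)"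
      using l(1) by (auto simp: path_sizes_def)
    then show False
      using l(2) that by (auto simp: path_systems_def)
  qed
  then have "{ps \<in> path_systems A. path_sizes ps = v} = {}" by blast
  then show ?thesis
    using False by (simp only: card.empty if_False)
qed

lemma finite_path_systems_size:
  assumes "finite A"
  shows "finite {ps \<in> path_systems A. system_size ps \<le> k}"
proof (rule finite_subset)
  show "{ps \<in> path_systems A. system_size ps \<le> k} \<subseteq>
      {ps. set ps \<subseteq> {p. set p \<subseteq> Pow A \<and> length p \<le> k} \<and> length ps \<le> k}"
  proof clarify
    fix ps assume ps: "ps \<in> path_systems A" "system_size ps \<le> k"
    have "partition_on A (set (concat ps))"
      using ps(1) unfolding path_systems_def by blast
    then have "A = \<Union>(set (concat ps))"
      by (rule partition_onD1)
    moreover have "length p \<le> length (concat ps)" if "p \<in> set ps" for p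
      using that by (simp add: length_concat member_le_sum_list)
    ultimately show "set ps \<subseteq> {p. set p \<subseteq> Pow A \<and> length p \<le> k} \<and> length ps \<le> k"
      using ps(2) by (force simp: system_size_conv_length)
  qed
  show "finite {ps. set ps \<subseteq> {p. set p \<subseteq> Pow A \<and> length p \<le> k} \<and> length ps \<le> k}"
    using assms by (intro finite_lists_length_le) auto
qed

lemma inverse_card_system_matrix_fibre:
  assumes ps: "ps \<in> path_systems {..<m}" "system_size ps \<le> k"
  shows "1 / of_nat (card {qs \<in> {qs \<in> path_systems {..<m}. system_size qs \<le> k}.
      system_matrix m qs = system_matrix m ps}) =
    (\<Prod>l\<leftarrow>path_sizes ps. path_weight l) / fact (length (path_sizes ps))"
proof -
  have "1 / of_nat (\<Prod>p\<leftarrow>ps. if length p = 1 then 1 else 2) = (\<Prod>l\<leftarrow>path_sizes ps. path_weight l)"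
    if "[] \<notin> set ps"
    using that
  proof (induction ps)
    case (Cons p ps)
    have "1 / of_nat (if length p = 1 then 1 else 2) = path_weight (Suc (length p))"
      using Cons.prems by (auto simp: path_weight_def)
    moreover have "1 / of_nat (\<Prod>p\<leftarrow>ps. if length p = 1 then 1 else 2) = (\<Prod>l\<leftarrow>path_sizes ps. path_weight l)"
      using Cons by simp
    ultimately show ?case
      unfolding path_sizes_def list.map prod_list.Cons
      by (metis (no_types, lifting) mult_1 of_nat_mult times_divide_times_eq)
  qed (simp add: path_sizes_def)
  moreover have "[] \<notin> set ps"
    using ps by (simp add: path_systems_def)
  ultimately have "(\<Prod>l\<leftarrow>path_sizes ps. path_weight l) = 1 / of_nat (\<Prod>p\<leftarrow>ps. if length p = 1 then 1 else 2)"
    by simp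
  then show ?thesis
    unfolding card_system_matrix_fibre[OF ps] by (simp add: path_sizes_def)
qed

text \<open>Each path system is weighted by the reciprocal of its fibre size, so every matrix counts
  once. Both weight and number of systems depend only on the path sizes, along which the sum is
  grouped.\<close>

lemma bott_samelson_count_div_fact:
  "of_nat (bott_samelson_count n m) / fact m =
    (\<Sum>N\<le>Suc n. fps_nth (fps_nth (exp_y path_series) N) m)"
proof -
  define X where "X = {ps \<in> path_systems {..<m}. system_size ps \<le> Suc n}"
  define T where "T = (SIGMA N:{..Suc n}. SIGMA c:{..N}. natpermute N c)"
  define wt where "wt v = (\<Prod>l\<leftarrow>v. path_weight l) / fact (length v)" for v
  \<comment> \<open>The three components are the indices \<open>N\<close>, \<open>c\<close>,
    \<open>v\<close> of the sum in \<open>exp_y_path_series_nth\<close>.\<close>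
  define stat where "stat ps = (system_size ps, length ps, path_sizes ps)" for ps :: "nat set list list"
  have fin: "finite X"
    unfolding X_def by (rule finite_path_systems_size) simp
  have size: "system_size ps = sum_list (path_sizes ps)" for ps :: "nat set list list"
    by (simp add: system_size_def path_sizes_def)
  have "of_nat (bott_samelson_count n m) = (\<Sum>ps\<in>X. wt (path_sizes ps))"
    unfolding bott_samelson_count_def bott_samelson_matrices_eq X_def[symmetric] sum_image_fibres[OF fin]
    by (intro sum.cong refl) (simp add: X_def wt_def inverse_card_system_matrix_fibre[simplified])
  also have "\<dots> = (\<Sum>t\<in>T. \<Sum>ps\<in>{ps \<in> X. stat ps = t}. wt (path_sizes ps))"
  proof (intro sum.group[symmetric] fin)
    show "finite T"
      unfolding T_def by (intro finite_SigmaI natpermute_finite) auto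
    show "stat ` X \<subseteq> T"
    proof (rule image_subsetI)
      fix ps assume "ps \<in> X"
      moreover have "length ps \<le> system_size ps"
        by (simp add: system_size_conv_length)
      ultimately show "stat ps \<in> T"
        by (simp add: stat_def T_def X_def natpermute_def size) (simp add: path_sizes_def)
    qed
  qed
  also have "\<dots> = (\<Sum>(N, c, v)\<in>T. fact m * ((\<Prod>l\<leftarrow>v. path_weight l) / fact c *
      fps_nth ((fps_exp 1 - 1) ^ (N - c)) m))"
  proof (intro sum.cong refl, clarify)
    fix N c v assume "(N, c, v) \<in> T"
    then have t: "N \<le> Suc n" "N = sum_list v" "c = length v"
      by (auto simp: T_def natpermute_def)
    have "{ps \<in> X. stat ps = (N, c, v)} = {ps \<in> path_systems {..<m}. path_sizes ps = v}"
      using t by (auto simp: X_def stat_def size) (simp add: path_sizes_def)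
    then have "(\<Sum>ps\<in>{ps \<in> X. stat ps = (N, c, v)}. wt (path_sizes ps)) =
        of_nat (card {ps \<in> path_systems {..<m}. path_sizes ps = v}) * wt v"
      by simp
    also have "\<dots> = fact m * ((\<Prod>l\<leftarrow>v. path_weight l) / fact c * fps_nth ((fps_exp 1 - 1) ^ (N - c)) m)"
    proof (cases "\<forall>l\<in>set v. 2 \<le> l")
      case True
      then show ?thesis
        unfolding card_path_systems_path_sizes wt_def t
        by (simp add: card_ordered_partitions)
    next
      case False
      then obtain l where "l \<in> set v" "\<not> 2 \<le> l"
        by blast
      moreover from this have "path_weight l = 0"
        by (simp add: path_weight_def)
      ultimately have "(\<Prod>l\<leftarrow>v. path_weight l) = 0"
        by (force simp: prod_list_zero_iff)
      then show ?thesis by (simp add: wt_def)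
    qed
    finally show "(\<Sum>ps\<in>{ps \<in> X. stat ps = (N, c, v)}. wt (path_sizes ps)) =
      fact m * ((\<Prod>l\<leftarrow>v. path_weight l) / fact c * fps_nth ((fps_exp 1 - 1) ^ (N - c)) m)" .
  qed
  also have "\<dots> = (\<Sum>N\<le>Suc n. \<Sum>c\<le>N. \<Sum>v\<in>natpermute N c. fact m * ((\<Prod>l\<leftarrow>v. path_weight l) / fact c *
      fps_nth ((fps_exp 1 - 1) ^ (N - c)) m))"
    unfolding T_def by (subst sum.Sigma[symmetric]; simp add: natpermute_finite sum.Sigma)
  also have "\<dots> = fact m * (\<Sum>N\<le>Suc n. fps_nth (fps_nth (exp_y path_series) N) m)"
    unfolding exp_y_path_series_nth sum_distrib_left ..
  finally show ?thesis by simp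
qed

theorem corollary1p2:
  shows "fps_xy_sum_ge1 (\<lambda>n m. of_nat (bott_samelson_count n m) / fact m) =
    (exp_y (var_y / 2 * (1 / (1 - var_y * (exp_x - 1)) + var_y * (exp_x - 1) - 1)) - 1)
      / (var_y * (1 - var_y))" (is "?S = _")
proof -
  let ?G = "exp_y path_series"
  have count_0_right: "bott_samelson_count n 0 = 1" for n
  proof -
    have "seqs n 0 = {[]}" by (auto simp: seqs_def)
    then show ?thesis by (simp add: bott_samelson_count_def)
  qed
  have count_0_left: "bott_samelson_count 0 m = 0" if "m \<noteq> 0" for m
  proof -
    have "seqs 0 m = {}" using that by (auto simp: seqs_def)
    then show ?thesis by (simp add: bott_samelson_count_def)
  qed
  \<comment> \<open>The subtracted 1 is the empty sequence at \<open>m = 0\<close>, which the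
    partial sums include and \<open>?S\<close> omits. For \<open>n = 0\<close> and positive
    \<open>m\<close> both sides vanish.\<close>
  have coeff: "fps_nth ?S n = (\<Sum>N\<le>Suc n. fps_nth ?G N) - 1" for n
  proof (intro fps_ext)
    fix m
    have "fps_nth (fps_nth ?S n) m =
        of_nat (bott_samelson_count n m) / fact m - (if m = 0 then 1 else 0)"
      using count_0_right count_0_left
      by (cases "m = 0"; cases "n = 0") (auto simp: fps_xy_sum_ge1_def)
    then show "fps_nth (fps_nth ?S n) m = fps_nth ((\<Sum>N\<le>Suc n. fps_nth ?G N) - 1) m"
      unfolding bott_samelson_count_div_fact by (simp add: fps_sum_nth)
  qed
  have G0: "fps_nth ?G 0 = 1"
    by (simp add: exp_y_def)
  \<comment> \<open>Multiplying by \<open>1 - var_y\<close> takes differences of the partial sums,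
    and multiplying by \<open>var_y\<close> shifts \<open>Suc n\<close> back to the exponent of
    \<open>y\<close>.\<close>
  have "?S * (var_y * (1 - var_y)) = ?G - 1"
  proof (rule fps_ext)
    fix k
    have expand: "?S * (var_y * (1 - var_y)) = fps_X * ?S - fps_X * (fps_X * ?S)"
      by (simp add: var_y_def algebra_simps)
    consider "k = 0" | "k = 1" | j where "k = Suc (Suc j)"
      by (metis One_nat_def not0_implies_Suc)
    then show "fps_nth (?S * (var_y * (1 - var_y))) k = fps_nth (?G - 1) k"
      unfolding expand by cases (simp_all add: coeff G0)
  qed
  \<comment> \<open>The division is exact, so the common nonzero factor can be cancelled at the
    end.\<close>
  also have "\<dots> = (?G - 1) / (var_y * (1 - var_y)) * (var_y * (1 - var_y))"
    by (rule exp_y_minus_1_div_times[symmetric])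
  finally have eq: "?S * (var_y * (1 - var_y)) = (?G - 1) / (var_y * (1 - var_y)) * (var_y * (1 - var_y))" .
  have nonzero: "var_y * (1 - var_y) \<noteq> 0"
  proof -
    have "fps_nth (var_y * (1 - var_y)) 1 = 1"
      by (simp add: var_y_def)
    then show ?thesis
      by (metis fps_zero_nth zero_neq_one)
  qed
  show ?thesis
    unfolding path_series_eq using eq by (simp only: mult_right_cancel[OF nonzero])
qed

end
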